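(* If $E$ is a semi-decidable IC equivalence relation on $\mathbb{N}$, then there are decidable IC equivalence relations $F$ and $G$ on $\mathbb{N}$ such that $E = FGF = F \vee G$.
   Context: $\mathbb{N}=\{0,1,2,\dots\}$. Relations are subsets of $\mathbb{N}\times\mathbb{N}$. "Decidable" means recursive (the characteristic function is computable); "semi-decidable" means recursively enumerable. An equivalence relation on $\mathbb{N}$ is called IC if every one of its equivalence classes is infinite. The composition of binary relations is $RS=\{(x,z) : \exists y\, [(x,y)\in R \text{ and } (y,z)\in S]\}$. $F\vee G$ denotes the join in the lattice of equivalence relations, i.e. the transitive closure of $F\cup G$. *)

theory Defs
  imports Main
begin

text \<open>
  Terms for the partial recursive (\<open>\<mu>\<close>-recursive) functions, with a common semantics on
  argument lists of every length. No arity discipline is needed: for each fixed length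
  a term denotes a partial recursive function of that many arguments, a mismatch of arities
  making it undefined.
\<close>

datatype recf =
    Zero
  | Succ
  | Proj nat
  | Comp recf "recf list"
  | Prec recf recf
  | Mu recf

text \<open>
  The result \<^term>\<open>None\<close> means divergence. Composition is strict in all its arguments, and
  minimisation diverges as soon as a value diverges before the first zero is reached.
\<close>

fun eval :: "recf \<Rightarrow> nat list \<Rightarrow> nat option" where
  "eval Zero xs = Some 0"
| "eval Succ xs = (case xs of [] \<Rightarrow> None | x # _ \<Rightarrow> Some (Suc x))"
| "eval (Proj i) xs = (if i < length xs then Some (xs ! i) else None)"
| "eval (Comp f gs) xs =
     (if \<forall>g\<in>set gs. eval g xs \<noteq> None then eval f (map (\<lambda>g. the (eval g xs)) gs) else None)"
| "eval (Prec f g) xs =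
     (case xs of
        [] \<Rightarrow> None
      | n # ys \<Rightarrow>
          rec_nat (eval f ys)
            (\<lambda>m r. case r of None \<Rightarrow> None | Some v \<Rightarrow> eval g (m # v # ys)) n)"
| "eval (Mu f) xs =
     (if \<exists>n. eval f (n # xs) = Some 0 \<and> (\<forall>m<n. eval f (m # xs) \<noteq> None)
      then Some (LEAST n. eval f (n # xs) = Some 0) else None)"

definition decidable :: "(nat \<times> nat) set \<Rightarrow> bool" where
  "decidable R \<longleftrightarrow> (\<exists>p. \<forall>x y. eval p [x, y] = Some (if (x, y) \<in> R then 1 else 0))"

text \<open>Recursively enumerable, as the domain of a partial recursive function.\<close>

definition semi_decidable :: "(nat \<times> nat) set \<Rightarrow> bool" where
  "semi_decidable R \<longleftrightarrow> (\<exists>p. \<forall>x y. (x, y) \<in> R \<longleftrightarrow> eval p [x, y] \<noteq> None)"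

definition IC :: "(nat \<times> nat) set \<Rightarrow> bool" where
  "IC E \<longleftrightarrow> equiv UNIV E \<and> (\<forall>C \<in> UNIV // E. infinite C)"

end

theory Submission
  imports Defs "HOL-Library.Infinite_Set"
begin

text \<open>
  Bounding the resources of the program for \<open>E\<close> yields a computable enumeration of \<open>E\<close> by pairs
  \<open>(a s, b s)\<close> with \<open>a s, b s \<le> s\<close>, each occurring infinitely often. As the classes are infinite,
  one can search for numbers \<open>h 1 < h 2 < \<dots>\<close> such that \<open>h (Suc s)\<close> is equivalent to \<open>a s\<close>.
  Let \<open>F\<close> be generated by the pairs \<open>(h (Suc s), b s)\<close> and \<open>G\<close> by the pairs \<open>(h (Suc s), a s)\<close>.
  Since \<open>a s, b s \<le> s < h (Suc s)\<close> and \<open>h\<close> is increasing, a number has at most one generator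
  leading to a smaller number, so both relations are decidable by descending to a root. Finally
  \<open>a s\<close> is related by \<open>G\<close> to \<open>h (Suc s)\<close>, which is related by \<open>F\<close> to \<open>b s\<close>, so that already
  \<open>E = G O F\<close>.
\<close>

section \<open>Total computable functions\<close>

text \<open>Functions act on whole argument lists, so that closure rules can be resolved against any
  body in \<open>xs\<close>; only lists of length \<open>k\<close> are constrained.\<close>

definition computable :: "nat \<Rightarrow> (nat list \<Rightarrow> nat) \<Rightarrow> bool" where
  "computable k f \<longleftrightarrow> (\<exists>p. \<forall>xs. length xs = k \<longrightarrow> eval p xs = Some (f xs))"

text \<open>Componentwise computability provides the inner programs of \<open>Comp\<close>, and the
  length condition makes the tuple fit the outer function.\<close>

definition computable_list :: "nat \<Rightarrow> nat \<Rightarrow> (nat list \<Rightarrow> nat list) \<Rightarrow> bool" where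
  "computable_list k m f \<longleftrightarrow>
     (\<forall>xs. length xs = k \<longrightarrow> length (f xs) = m) \<and> (\<forall>i<m. computable k (\<lambda>xs. f xs ! i))"

lemma computable_cong:
  assumes "computable k f" and "\<And>xs. length xs = k \<Longrightarrow> f xs = g xs"
  shows "computable k g"
  using assms unfolding computable_def by metis

lemma computable_nth: "i < k \<Longrightarrow> computable k (\<lambda>xs. xs ! i)"
  unfolding computable_def by (rule exI[of _ "Proj i"]) simp

lemma computable_comp:
  assumes f: "computable m f" and g: "computable_list k m g"
  shows "computable k (\<lambda>xs. f (g xs))"
proof -
  obtain p where p: "\<And>ys. length ys = m \<Longrightarrow> eval p ys = Some (f ys)"
    using f unfolding computable_def by blast
  have "\<forall>i. \<exists>q. i < m \<longrightarrow> (\<forall>xs. length xs = k \<longrightarrow> eval q xs = Some (g xs ! i))"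
    using g unfolding computable_list_def computable_def by blast
  then obtain q where q: "\<And>i xs. i < m \<Longrightarrow> length xs = k \<Longrightarrow> eval (q i) xs = Some (g xs ! i)"
    by metis
  have "eval (Comp p (map q [0..<m])) xs = Some (f (g xs))" if xs: "length xs = k" for xs
  proof -
    have "length (g xs) = m"
      using g xs unfolding computable_list_def by blast
    then have "map (\<lambda>r. the (eval r xs)) (map q [0..<m]) = g xs"
      by (intro nth_equalityI) (auto simp: q xs)
    moreover have "\<forall>r\<in>set (map q [0..<m]). eval r xs \<noteq> None"
      using q xs by auto
    ultimately show ?thesis
      using p[OF \<open>length (g xs) = m\<close>] by (simp del: map_map)
  qed
  then show ?thesis
    unfolding computable_def by blast
qed

lemma computable_list_id: "computable_list k k (\<lambda>xs. xs)"
  by (simp add: computable_list_def computable_nth)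

lemma computable_list_Nil: "computable_list k 0 (\<lambda>xs. [])"
  by (simp add: computable_list_def)

lemma computable_list_Cons:
  assumes "computable k g" and "computable_list k m f"
  shows "computable_list k (Suc m) (\<lambda>xs. g xs # f xs)"
  using assms by (auto simp: computable_list_def less_Suc_eq_0_disj)

lemma computable_list_tl:
  assumes "computable_list k (Suc m) f"
  shows "computable_list k m (\<lambda>xs. tl (f xs))"
  unfolding computable_list_def
proof (intro conjI allI impI)
  show "length (tl (f xs)) = m" if "length xs = k" for xs
    using assms that by (simp add: computable_list_def)
  show "computable k (\<lambda>xs. tl (f xs) ! i)" if "i < m" for i
    using assms that computable_cong[of k "\<lambda>xs. f xs ! Suc i"]
    by (simp add: computable_list_def nth_tl)
qed

lemma computable_hd:
  assumes "computable_list k (Suc m) f"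
  shows "computable k (\<lambda>xs. hd (f xs))"
proof (rule computable_cong)
  show "computable k (\<lambda>xs. f xs ! 0)"
    using assms unfolding computable_list_def by blast
  show "f xs ! 0 = hd (f xs)" if "length xs = k" for xs
    using assms that unfolding computable_list_def by (metis Zero_neq_Suc hd_conv_nth list.size(3))
qed

text \<open>Arguments are addressed by \<open>hd\<close> and \<open>tl\<close> rather than by index,
  which makes these rules syntax-directed.\<close>

lemmas computable_list_intros =
  computable_list_id computable_list_Nil computable_list_Cons computable_list_tl computable_hd

lemma computable_comp1:
  assumes "computable (Suc 0) (\<lambda>xs. f (hd xs))" and "computable k g"
  shows "computable k (\<lambda>xs. f (g xs))"
  using computable_comp[OF assms(1), of k "\<lambda>xs. [g xs]"] assms(2)
  by (simp add: computable_list_intros)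

lemma computable_comp2:
  assumes "computable (Suc (Suc 0)) (\<lambda>xs. f (hd xs) (hd (tl xs)))"
    and "computable k g" and "computable k h"
  shows "computable k (\<lambda>xs. f (g xs) (h xs))"
  using computable_comp[OF assms(1), of k "\<lambda>xs. [g xs, h xs]"] assms(2,3)
  by (simp add: computable_list_intros)

lemma computable_Suc:
  assumes "computable k f"
  shows "computable k (\<lambda>xs. Suc (f xs))"
proof (rule computable_comp1[of Suc, OF _ assms])
  show "computable (Suc 0) (\<lambda>xs. Suc (hd xs))"
    unfolding computable_def by (rule exI[of _ Succ]) (auto simp: length_Suc_conv)
qed

lemma computable_const: "computable k (\<lambda>xs. c)"
proof (induction c)
  case 0
  show ?case unfolding computable_def by (rule exI[of _ Zero]) simp
qed (rule computable_Suc)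

text \<open>\<open>Prec\<close> recurses on the first list entry, so the recursion is first built
  with a counter in front of \<open>xs\<close>; then \<open>n xs\<close> is substituted for the
  counter.\<close>

lemma computable_rec_nat:
  assumes n: "computable k n" and f: "computable k f"
    and g: "computable (Suc (Suc k)) (\<lambda>ys. g (hd ys) (hd (tl ys)) (tl (tl ys)))"
  shows "computable k (\<lambda>xs. rec_nat (f xs) (\<lambda>m r. g m r xs) (n xs))"
proof -
  obtain p where p: "\<And>xs. length xs = k \<Longrightarrow> eval p xs = Some (f xs)"
    using f unfolding computable_def by blast
  obtain q where q: "\<And>ys. length ys = Suc (Suc k) \<Longrightarrow>
      eval q ys = Some (g (hd ys) (hd (tl ys)) (tl (tl ys)))"
    using g unfolding computable_def by blast
  have "eval (Prec p q) (i # xs) = Some (rec_nat (f xs) (\<lambda>m r. g m r xs) i)"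
    if "length xs = k" for i xs
    by (induction i) (simp_all add: p q that)
  then have "computable (Suc k) (\<lambda>ys. rec_nat (f (tl ys)) (\<lambda>m r. g m r (tl ys)) (hd ys))"
    unfolding computable_def by (intro exI[of _ "Prec p q"]) (auto simp: length_Suc_conv)
  from computable_comp[OF this computable_list_Cons[OF n computable_list_id]]
  show ?thesis by simp
qed

section \<open>Arithmetic, Boolean combinations and search\<close>

lemma computable_pred:
  assumes "computable k f"
  shows "computable k (\<lambda>xs. f xs - 1)"
proof (rule computable_cong)
  show "computable k (\<lambda>xs. rec_nat 0 (\<lambda>m r. m) (f xs))"
    by (rule computable_rec_nat assms computable_const computable_list_intros)+
  show "rec_nat 0 (\<lambda>m r. m) (f xs) = f xs - 1" for xs
    by (cases "f xs") simp_all
qed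

lemma computable_add:
  assumes "computable k f" and "computable k g"
  shows "computable k (\<lambda>xs. f xs + g xs)"
proof (rule computable_cong)
  show "computable k (\<lambda>xs. rec_nat (f xs) (\<lambda>m r. Suc r) (g xs))"
    by (rule computable_rec_nat assms computable_Suc computable_list_intros)+
  have "rec_nat x (\<lambda>m r. Suc r) y = x + y" for x y
    by (induction y) simp_all
  then show "rec_nat (f xs) (\<lambda>m r. Suc r) (g xs) = f xs + g xs" for xs .
qed

lemma computable_diff:
  assumes "computable k f" and "computable k g"
  shows "computable k (\<lambda>xs. f xs - g xs)"
proof (rule computable_cong)
  show "computable k (\<lambda>xs. rec_nat (f xs) (\<lambda>m r. r - 1) (g xs))"
    by (rule computable_rec_nat assms computable_pred computable_list_intros)+
  have "rec_nat x (\<lambda>m r. r - 1) y = x - y" for x y :: nat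
    by (induction y) simp_all
  then show "rec_nat (f xs) (\<lambda>m r. r - 1) (g xs) = f xs - g xs" for xs .
qed

lemma computable_mult:
  assumes "computable k f" and "computable k g"
  shows "computable k (\<lambda>xs. f xs * g xs)"
proof (rule computable_cong)
  \<comment> \<open>Under the recursion the parameters sit behind the counter and the previous
    value.\<close>
  have *: "computable (Suc (Suc k)) (\<lambda>ys. f (tl (tl ys)))"
    by (rule computable_comp[OF assms(1)]) (intro computable_list_intros)
  show "computable k (\<lambda>xs. rec_nat 0 (\<lambda>m r. r + f xs) (g xs))"
    by (rule * computable_rec_nat assms computable_add computable_const computable_list_intros)+
  have "rec_nat 0 (\<lambda>m r. r + x) y = x * y" for x y :: nat
    by (induction y) simp_all
  then show "rec_nat 0 (\<lambda>m r. r + f xs) (g xs) = f xs * g xs" for xs .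
qed

lemma computable_not:
  assumes "computable k (\<lambda>xs. of_bool (P xs))"
  shows "computable k (\<lambda>xs. of_bool (\<not> P xs))"
  by (rule computable_cong[OF computable_diff[OF computable_const[of k 1] assms]]) simp

lemma computable_conj:
  assumes "computable k (\<lambda>xs. of_bool (P xs))" and "computable k (\<lambda>xs. of_bool (Q xs))"
  shows "computable k (\<lambda>xs. of_bool (P xs \<and> Q xs))"
  by (rule computable_cong[OF computable_mult[OF assms]]) simp

text \<open>Truncated subtraction decides the order: \<open>1 - (f xs - g xs)\<close> is 1 exactly
  when \<open>f xs - g xs\<close> is 0.\<close>

lemma computable_le:
  assumes "computable k f" and "computable k g"
  shows "computable k (\<lambda>xs. of_bool (f xs \<le> g xs))"
  by (rule computable_cong[OF computable_diff[OF computable_const[of k 1]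
        computable_diff[OF assms]]]) auto

lemma computable_less:
  assumes "computable k f" and "computable k g"
  shows "computable k (\<lambda>xs. of_bool (f xs < g xs))"
  using computable_not[OF computable_le[OF assms(2,1)]] by (simp add: not_le)

lemma computable_disj:
  assumes "computable k (\<lambda>xs. of_bool (P xs))" and "computable k (\<lambda>xs. of_bool (Q xs))"
  shows "computable k (\<lambda>xs. of_bool (P xs \<or> Q xs))"
  using computable_not[OF computable_conj[OF assms[THEN computable_not]]] by simp

lemma computable_eq:
  assumes "computable k f" and "computable k g"
  shows "computable k (\<lambda>xs. of_bool (f xs = g xs))"
  using computable_conj[OF computable_le[OF assms] computable_le[OF assms(2,1)]]
  by (simp add: eq_iff)

lemma computable_if:
  assumes "computable k (\<lambda>xs. of_bool (P xs))" and "computable k f" and "computable k g"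
  shows "computable k (\<lambda>xs. if P xs then f xs else g xs)"
  by (rule computable_cong[OF computable_add[OF computable_mult[OF assms(1,2)]
        computable_mult[OF computable_not[OF assms(1)] assms(3)]]]) simp

text \<open>\<open>Mu\<close> looks for a zero, so it is applied to the program for the negated
  predicate. That program is total, and \<open>ex\<close> makes the search stop.\<close>

lemma computable_Least:
  assumes P: "computable (Suc k) (\<lambda>ys. of_bool (P (hd ys) (tl ys)))"
    and ex: "\<And>xs. length xs = k \<Longrightarrow> \<exists>n. P n xs"
  shows "computable k (\<lambda>xs. LEAST n. P n xs)"
proof -
  obtain p where p: "\<And>ys. length ys = Suc k \<Longrightarrow> eval p ys = Some (of_bool (\<not> P (hd ys) (tl ys)))"
    using computable_not[OF P] unfolding computable_def by blast
  have "eval (Mu p) xs = Some (LEAST n. P n xs)" if "length xs = k" for xs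
    using ex[OF that] p that by simp
  then show ?thesis
    unfolding computable_def by blast
qed

lemmas computable_intros =
  computable_list_intros computable_const computable_Suc computable_pred computable_add
  computable_diff computable_mult computable_not computable_conj computable_disj computable_le
  computable_less computable_eq computable_if

lemma decidable_iff_computable:
  "decidable R \<longleftrightarrow> computable (Suc (Suc 0)) (\<lambda>xs. of_bool ((hd xs, hd (tl xs)) \<in> R))"
proof -
  have "(\<forall>x y. Q [x, y]) \<longleftrightarrow> (\<forall>xs. length xs = Suc (Suc 0) \<longrightarrow> Q xs)" for Q :: "nat list \<Rightarrow> bool"
    by (auto simp: length_Suc_conv)
  from this[of "\<lambda>xs. eval p xs = Some (of_bool ((hd xs, hd (tl xs)) \<in> R))" for p]
  show ?thesis
    unfolding decidable_def computable_def by (simp add: of_bool_def)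
qed

section \<open>Evaluation with bounded resources\<close>

text \<open>
  The value 0 means that the computation has not terminated within the bound, which is the
  head of the argument list, and \<open>Suc v\<close> that it has returned \<open>v\<close>.
\<close>

definition approximates :: "nat \<Rightarrow> (nat list \<Rightarrow> nat option) \<Rightarrow> (nat list \<Rightarrow> nat) \<Rightarrow> bool" where
  "approximates k f T \<longleftrightarrow> computable (Suc k) T \<and>
     (\<forall>xs. length xs = k \<longrightarrow>
       (\<forall>t v. T (t # xs) = Suc v \<longrightarrow> f xs = Some v) \<and>
       (\<forall>v. f xs = Some v \<longrightarrow> (\<forall>\<^sub>F t in sequentially. T (t # xs) = Suc v)))"


lemma approximatesI:
  assumes "computable (Suc k) T"
    and "\<And>xs t v. length xs = k \<Longrightarrow> T (t # xs) = Suc v \<Longrightarrow> f xs = Some v"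
    and "\<And>xs v. length xs = k \<Longrightarrow> f xs = Some v \<Longrightarrow>
           \<forall>\<^sub>F t in sequentially. T (t # xs) = Suc v"
  shows "approximates k f T"
  using assms unfolding approximates_def by blast

lemma approximates_computable: "approximates k f T \<Longrightarrow> computable (Suc k) T"
  by (simp add: approximates_def)

lemma approximates_sound:
  "approximates k f T \<Longrightarrow> length xs = k \<Longrightarrow> T (t # xs) = Suc v \<Longrightarrow> f xs = Some v"
  unfolding approximates_def by blast

lemma approximates_complete:
  "approximates k f T \<Longrightarrow> length xs = k \<Longrightarrow> f xs = Some v \<Longrightarrow>
    \<forall>\<^sub>F t in sequentially. T (t # xs) = Suc v"
  unfolding approximates_def by blast

lemma approximates_None:
  assumes "\<And>xs. length xs = k \<Longrightarrow> f xs = None"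
  shows "approximates k f (\<lambda>_. 0)"
  by (rule approximatesI) (auto simp: assms computable_const)

lemma approximates_total:
  assumes "computable k g" and "\<And>xs. length xs = k \<Longrightarrow> f xs = Some (g xs)"
  shows "approximates k f (\<lambda>ys. Suc (g (tl ys)))"
  by (rule approximatesI)
    (auto simp: assms intro!: computable_Suc computable_comp[OF assms(1)] computable_list_tl
      computable_list_id)

section \<open>Bounded evaluation of compound terms\<close>

lemma computable_all_list:
  assumes "\<And>g. g \<in> set gs \<Longrightarrow> computable k (\<lambda>xs. of_bool (P g xs))"
  shows "computable k (\<lambda>xs. of_bool (\<forall>g\<in>set gs. P g xs))"
  using assms
proof (induction gs)
  case Nil
  show ?case by (simp add: computable_const)
next
  case (Cons g gs)
  then show ?case
    using computable_conj[of k "P g" "\<lambda>xs. \<forall>g\<in>set gs. P g xs"] by simp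
qed

lemma computable_list_map:
  assumes "\<And>g. g \<in> set gs \<Longrightarrow> computable k (h g)"
  shows "computable_list k (length gs) (\<lambda>xs. map (\<lambda>g. h g xs) gs)"
  using assms by (induction gs) (simp_all add: computable_list_Nil computable_list_Cons)

text \<open>One bound serves the inner programs and the outer one. A missing inner value yields 0,
  as composition is strict; if all inner values exist, they are all found from some bound on, being
  finitely many.\<close>

lemma approximates_Comp:
  assumes f: "approximates (length gs) (eval f) Tf"
    and g: "\<And>g. g \<in> set gs \<Longrightarrow> approximates k (eval g) (Tg g)"
  shows "approximates k (eval (Comp f gs))
    (\<lambda>ys. if \<forall>g\<in>set gs. 0 < Tg g ys then Tf (hd ys # map (\<lambda>g. Tg g ys - 1) gs) else 0)"
    (is "approximates k _ ?T")
proof (rule approximatesI)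
  have Tg: "computable (Suc k) (Tg g)" if "g \<in> set gs" for g
    using g[OF that] by (rule approximates_computable)
  have "computable (Suc k) (\<lambda>ys. Tf (hd ys # map (\<lambda>g. Tg g ys - 1) gs))"
    by (rule computable_comp[OF approximates_computable[OF f]])
      (rule computable_list_Cons computable_list_map computable_hd computable_list_id
        computable_pred Tg | assumption)+
  moreover have "computable (Suc k) (\<lambda>ys. of_bool (\<forall>g\<in>set gs. 0 < Tg g ys))"
    by (rule computable_all_list computable_less computable_const Tg | assumption)+
  ultimately show "computable (Suc k) ?T"
    by (intro computable_if computable_const)
next
  fix xs t v
  assume xs: "length xs = k" and T: "?T (t # xs) = Suc v"
  from T have pos: "\<forall>g\<in>set gs. 0 < Tg g (t # xs)"
    and v: "Tf (t # map (\<lambda>g. Tg g (t # xs) - 1) gs) = Suc v"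
    by (simp_all split: if_splits)
  have ev: "eval g xs = Some (Tg g (t # xs) - 1)" if "g \<in> set gs" for g
    by (rule approximates_sound[OF g[OF that] xs, of t]) (use pos that in auto)
  have "map (\<lambda>g. the (eval g xs)) gs = map (\<lambda>g. Tg g (t # xs) - 1) gs"
    by (simp add: ev)
  then have "eval f (map (\<lambda>g. the (eval g xs)) gs) = Some v"
    using approximates_sound[OF f _ v] by (simp only: length_map)
  then show "eval (Comp f gs) xs = Some v"
    by (simp add: ev)
next
  fix xs v
  assume xs: "length xs = k" and "eval (Comp f gs) xs = Some v"
  then have def: "\<forall>g\<in>set gs. eval g xs \<noteq> None"
    and v: "eval f (map (\<lambda>g. the (eval g xs)) gs) = Some v"
    by (simp_all split: if_splits)
  have "\<forall>\<^sub>F t in sequentially. \<forall>g\<in>set gs. Tg g (t # xs) = Suc (the (eval g xs))"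
    using def by (intro eventually_ball_finite ballI approximates_complete[OF g xs]) auto
  moreover have "\<forall>\<^sub>F t in sequentially. Tf (t # map (\<lambda>g. the (eval g xs)) gs) = Suc v"
    by (rule approximates_complete[OF f _ v]) simp
  ultimately show "\<forall>\<^sub>F t in sequentially. ?T (t # xs) = Suc v"
  proof eventually_elim
    case (elim t)
    then have "map (\<lambda>g. Tg g (t # xs) - 1) gs = map (\<lambda>g. the (eval g xs)) gs"
      by simp
    with elim show ?case by (simp del: map_eq_conv)
  qed
qed

text \<open>The whole recursion runs under one bound. A failure 0 is passed on to all later values,
  and \<open>r - 1\<close> is the value that a positive \<open>r\<close> stands for.\<close>

lemma approximates_Prec:
  assumes f: "approximates k (eval f) Tf" and g: "approximates (Suc (Suc k)) (eval g) Tg"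
  shows "approximates (Suc k) (eval (Prec f g))
    (\<lambda>ys. rec_nat (Tf (hd ys # tl (tl ys)))
       (\<lambda>m r. if r = 0 then 0 else Tg (hd ys # m # (r - 1) # tl (tl ys))) (hd (tl ys)))"
    (is "approximates _ _ ?T")
proof (rule approximatesI)
  let ?k = "Suc (Suc k)"
  have "computable ?k (\<lambda>ys. Tf (hd ys # tl (tl ys)))"
    by (rule computable_comp[OF approximates_computable[OF f]]) (rule computable_list_intros)+
  moreover have "computable (Suc (Suc ?k)) (\<lambda>ys. if hd (tl ys) = 0 then 0 else
      Tg (hd (tl (tl ys)) # hd ys # (hd (tl ys) - 1) # tl (tl (tl (tl ys)))))"
    by (rule computable_intros computable_comp[OF approximates_computable[OF g]])+
  ultimately show "computable ?k ?T"
    by (intro computable_rec_nat) (assumption | rule computable_intros)+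
next
  fix xs t v
  assume "length xs = Suc k" and T: "?T (t # xs) = Suc v"
  then obtain n ys where xs: "xs = n # ys" and ys: "length ys = k"
    by (auto simp: length_Suc_conv)
  define R where
    "R = rec_nat (Tf (t # ys)) (\<lambda>m r. if r = 0 then 0 else Tg (t # m # (r - 1) # ys))"
  have R_0: "R 0 = Tf (t # ys)"
    and R_Suc: "\<And>i. R (Suc i) = (if R i = 0 then 0 else Tg (t # i # (R i - 1) # ys))"
    by (simp_all add: R_def)
  have sound: "R i = Suc v \<Longrightarrow> eval (Prec f g) (i # ys) = Some v" for i v
  proof (induction i arbitrary: v)
    case 0
    then show ?case using approximates_sound[OF f ys] R_0 by simp
  next
    case (Suc i)
    from Suc.prems obtain w where w: "R i = Suc w"
      by (cases "R i") (simp_all add: R_Suc)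
    have "Tg (t # i # w # ys) = Suc v"
      using Suc.prems w by (simp add: R_Suc)
    then have "eval g (i # w # ys) = Some v"
      using approximates_sound[OF g] ys by simp
    then show ?case using Suc.IH[OF w] by simp
  qed
  have "R n = Suc v"
    using T by (simp add: R_def xs cong: if_cong)
  then show "eval (Prec f g) xs = Some v"
    unfolding xs by (rule sound)
next
  fix xs v
  assume "length xs = Suc k" and v: "eval (Prec f g) xs = Some v"
  then obtain n ys where xs: "xs = n # ys" and ys: "length ys = k"
    by (auto simp: length_Suc_conv)
  have complete: "eval (Prec f g) (i # ys) = Some v \<Longrightarrow>
      \<forall>\<^sub>F t in sequentially. ?T (t # i # ys) = Suc v" for i v
  proof (induction i arbitrary: v)
    case 0
    then show ?case using approximates_complete[OF f ys] by simp
  next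
    case (Suc i)
    from Suc.prems obtain w where w: "eval (Prec f g) (i # ys) = Some w"
      and v: "eval g (i # w # ys) = Some v"
      by (auto split: option.splits)
    have "\<forall>\<^sub>F t in sequentially. Tg (t # i # w # ys) = Suc v"
      by (rule approximates_complete[OF g _ v]) (simp add: ys)
    with Suc.IH[OF w] show ?case
      by eventually_elim (simp cong: if_cong)
  qed
  show "\<forall>\<^sub>F t in sequentially. ?T (t # xs) = Suc v"
    using v unfolding xs by (rule complete)
qed

text \<open>
  The search for the zero stops at the first argument at which the bounded evaluation shows
  anything but a positive value, and at the bound at the latest.
\<close>

lemma approximates_Mu:
  assumes f: "approximates (Suc k) (eval f) Tf"
  shows "approximates k (eval (Mu f))
    (\<lambda>ys. if Tf (hd ys # (LEAST n. hd ys \<le> n \<or> Tf (hd ys # n # tl ys) \<le> 1) # tl ys) = 1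
      then Suc (LEAST n. hd ys \<le> n \<or> Tf (hd ys # n # tl ys) \<le> 1) else 0)"
    (is "approximates _ _ ?T")
proof (rule approximatesI)
  note comp_f = computable_comp[OF approximates_computable[OF f]]
  \<comment> \<open>The disjunct \<open>hd ys \<le> n\<close> makes the search total, as
    \<open>computable_Least\<close> requires.\<close>
  have "computable (Suc k) (\<lambda>ys. LEAST n. hd ys \<le> n \<or> Tf (hd ys # n # tl ys) \<le> 1)"
    by (rule computable_Least) (rule computable_intros comp_f | blast)+
  then show "computable (Suc k) ?T"
    by - (rule computable_intros comp_f | assumption)+
next
  fix xs t v
  assume xs: "length xs = k" and T: "?T (t # xs) = Suc v"
  then have v: "v = (LEAST n. t \<le> n \<or> Tf (t # n # xs) \<le> 1)" and Tv: "Tf (t # v # xs) = Suc 0"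
    by (simp_all split: if_splits)
  have zero: "eval f (v # xs) = Some 0"
    using approximates_sound[OF f _ Tv] xs by simp
  have pos: "\<exists>w. eval f (m # xs) = Some (Suc w)" if "m < v" for m
  proof -
    \<comment> \<open>The search has passed \<open>m\<close>. Results are shifted by one, so
      exceeding 1 means a positive value of \<open>f\<close>.\<close>
    have "1 < Tf (t # m # xs)"
      using not_less_Least[of m "\<lambda>n. t \<le> n \<or> Tf (t # n # xs) \<le> 1"] that v by simp
    then obtain w where "Tf (t # m # xs) = Suc (Suc w)"
      by (metis One_nat_def less_imp_Suc_add add_Suc_right add_Suc)
    then show ?thesis
      using approximates_sound[OF f] xs by auto
  qed
  have "(LEAST n. eval f (n # xs) = Some 0) = v"
    by (rule Least_equality) (use zero pos in \<open>force simp: not_le[symmetric]\<close>)+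
  moreover have "\<forall>m<v. eval f (m # xs) \<noteq> None"
    using pos by force
  ultimately show "eval (Mu f) xs = Some v"
    using zero by auto
next
  fix xs v
  assume xs: "length xs = k" and ev: "eval (Mu f) xs = Some v"
  then obtain n where n: "eval f (n # xs) = Some 0" "\<forall>m<n. eval f (m # xs) \<noteq> None"
    and v: "v = (LEAST n. eval f (n # xs) = Some 0)"
    by (auto split: if_splits)
  have zero: "eval f (v # xs) = Some 0"
    unfolding v using n(1) by (rule LeastI)
  have pos: "\<exists>w. eval f (m # xs) = Some (Suc w)" if "m < v" for m
  proof -
    have "v \<le> n"
      unfolding v using n(1) by (rule Least_le)
    then have "eval f (m # xs) \<noteq> None"
      using n(2) that by (meson less_le_trans)
    then obtain w where w: "eval f (m # xs) = Some w"
      by blast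
    have "w \<noteq> 0"
      using w not_less_Least[of m "\<lambda>n. eval f (n # xs) = Some 0"] that v by auto
    with w show ?thesis
      by (metis not0_implies_Suc)
  qed
  have "\<forall>\<^sub>F t in sequentially. \<forall>m\<in>{..<v}. Tf (t # m # xs) = Suc (the (eval f (m # xs)))"
    using pos xs by (intro eventually_ball_finite ballI approximates_complete[OF f]) force+
  moreover have "\<forall>\<^sub>F t in sequentially. Tf (t # v # xs) = Suc 0"
    by (rule approximates_complete[OF f _ zero]) (simp add: xs)
  \<comment> \<open>With \<open>v < t\<close> the bound cannot stop the search before
    \<open>v\<close>.\<close>
  moreover have "\<forall>\<^sub>F t in sequentially. v < t"
    by (rule eventually_gt_at_top)
  ultimately show "\<forall>\<^sub>F t in sequentially. ?T (t # xs) = Suc v"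
  proof eventually_elim
    case (elim t)
    have "(LEAST n. t \<le> n \<or> Tf (t # n # xs) \<le> 1) = v"
    proof (rule Least_equality)
      show "v \<le> m" if "t \<le> m \<or> Tf (t # m # xs) \<le> 1" for m
      proof (rule ccontr)
        assume "\<not> v \<le> m"
        then show False
          using that elim pos[of m] by auto
      qed
    qed (simp add: elim)
    then show ?case
      using elim by simp
  qed
qed

text \<open>Structural induction with \<open>k\<close> arbitrary, since subterms may be evaluated at
  other arities. At arities where a term is undefined everywhere the constant 0 serves.\<close>

lemma ex_approximates: "\<exists>T. approximates k (eval p) T"
proof (induction p arbitrary: k)
  case Zero
  show ?case
    by (rule exI, rule approximates_total[OF computable_const[of k 0]]) simp
next
  case Succ
  show ?case
  proof (cases k)
    case 0
    then show ?thesis by (intro exI[of _ "\<lambda>_. 0"] approximates_None) auto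
  next
    case (Suc m)
    have *: "computable k (\<lambda>xs. Suc (hd xs))"
      unfolding Suc by (rule computable_intros)+
    show ?thesis
      by (rule exI, rule approximates_total[OF *]) (auto simp: Suc length_Suc_conv)
  qed
next
  case (Proj i)
  show ?case
  proof (cases "i < k")
    case True
    show ?thesis
      by (rule exI, rule approximates_total[OF computable_nth[OF True]]) (simp add: True)
  next
    case False
    then show ?thesis by (intro exI[of _ "\<lambda>_. 0"] approximates_None) auto
  qed
next
  case (Comp f gs)
  obtain Tf where "approximates (length gs) (eval f) Tf"
    using Comp.IH(1) by blast
  moreover have "\<forall>g. \<exists>T. g \<in> set gs \<longrightarrow> approximates k (eval g) T"
    using Comp.IH(2) by blast
  then obtain Tg where "\<And>g. g \<in> set gs \<Longrightarrow> approximates k (eval g) (Tg g)"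
    by metis
  ultimately show ?case
    using approximates_Comp by blast
next
  case (Prec f g)
  show ?case
  proof (cases k)
    case 0
    then show ?thesis by (intro exI[of _ "\<lambda>_. 0"] approximates_None) auto
  next
    case (Suc m)
    then show ?thesis using Prec.IH approximates_Prec by blast
  qed
next
  case (Mu f)
  then show ?case using approximates_Mu by blast
qed

text \<open>\<open>T t x y\<close> says that the program for \<open>E\<close> is seen to halt on
  \<open>[x, y]\<close> under the bound \<open>t\<close>, that is, that its bounded evaluation is
  positive.\<close>

lemma semi_decidable_stages:
  assumes "semi_decidable E"
  obtains T :: "nat \<Rightarrow> nat \<Rightarrow> nat \<Rightarrow> bool"
  where "computable (Suc (Suc (Suc 0))) (\<lambda>xs. of_bool (T (hd xs) (hd (tl xs)) (hd (tl (tl xs)))))"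
    and "\<And>t x y. T t x y \<Longrightarrow> (x, y) \<in> E"
    and "\<And>x y. (x, y) \<in> E \<Longrightarrow> \<forall>\<^sub>F t in sequentially. T t x y"
proof -
  obtain p where p: "\<And>x y. (x, y) \<in> E \<longleftrightarrow> eval p [x, y] \<noteq> None"
    using assms unfolding semi_decidable_def by blast
  obtain T where T: "approximates (Suc (Suc 0)) (eval p) T"
    using ex_approximates by blast
  show thesis
  proof (rule that[of "\<lambda>t x y. 0 < T [t, x, y]"])
    show "computable (Suc (Suc (Suc 0)))
        (\<lambda>xs. of_bool (0 < T [hd xs, hd (tl xs), hd (tl (tl xs))]))"
      by (rule computable_intros computable_comp[OF approximates_computable[OF T]])+
    show "(x, y) \<in> E" if "0 < T [t, x, y]" for t x y
      using approximates_sound[OF T, of "[x, y]" t "T [t, x, y] - 1"] that p by auto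
    show "\<forall>\<^sub>F t in sequentially. 0 < T [t, x, y]" if xy: "(x, y) \<in> E" for x y
    proof -
      obtain v where v: "eval p [x, y] = Some v"
        using xy p by auto
      have "\<forall>\<^sub>F t in sequentially. T [t, x, y] = Suc v"
        by (rule approximates_complete[OF T _ v]) simp
      then show ?thesis
        by eventually_elim simp
    qed
  qed
qed

section \<open>Enumerating pairs\<close>

text \<open>The square root rounded down, written as a search so that
  \<open>computable_Least\<close> applies.\<close>

definition isqrt :: "nat \<Rightarrow> nat" where
  "isqrt n = (LEAST m. n < Suc m * Suc m)"

text \<open>
  The distance to the largest square below \<open>n\<close> takes every value infinitely often; together
  with its complement in the square root it runs through all pairs.
\<close>

definition left :: "nat \<Rightarrow> nat" where
  "left n = n - isqrt n * isqrt n"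

definition right :: "nat \<Rightarrow> nat" where
  "right n = isqrt n - left n"

lemma isqrt_eq: "i \<le> m \<Longrightarrow> isqrt (m * m + i) = m"
  unfolding isqrt_def
proof (rule Least_equality)
  show "m \<le> l" if "i \<le> m" "m * m + i < Suc l * Suc l" for l
  proof (rule ccontr)
    assume "\<not> m \<le> l"
    then have "Suc l * Suc l \<le> m * m" by (intro mult_le_mono) auto
    with that show False by simp
  qed
qed simp

lemma left_eq: "i \<le> m \<Longrightarrow> left (m * m + i) = i"
  by (simp add: left_def isqrt_eq)

text \<open>Beyond the square of \<open>x + y\<close>, the offset \<open>x\<close> leaves the
  complement \<open>y\<close>.\<close>

lemma ex_left_right: "\<exists>n. left n = x \<and> right n = y"
  by (rule exI[of _ "(x + y) * (x + y) + x"]) (simp add: left_eq right_def isqrt_eq)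

text \<open>Every square root that is at least \<open>x\<close> admits the offset \<open>x\<close>;
  adding \<open>N\<close> to it makes the witness large.\<close>

lemma ex_left_ge: "\<exists>n\<ge>N. left n = x"
proof (intro exI conjI)
  have "N + x \<le> (N + x) * (N + x)"
    by (rule le_square)
  then show "N \<le> (N + x) * (N + x) + x"
    by linarith
  show "left ((N + x) * (N + x) + x) = x"
    by (simp add: left_eq)
qed

lemma left_le: "left n \<le> n"
  by (simp add: left_def)

lemma right_le: "right n \<le> n"
proof -
  have "isqrt n \<le> n"
    unfolding isqrt_def by (rule Least_le) simp
  then show ?thesis
    by (simp add: right_def)
qed

lemma computable_isqrt: "computable k f \<Longrightarrow> computable k (\<lambda>xs. isqrt (f xs))"
proof (rule computable_comp1[of isqrt])
  have "\<exists>m. n < Suc m * Suc m" for n :: nat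
    by (rule exI[of _ n]) simp
  then show "computable (Suc 0) (\<lambda>xs. isqrt (hd xs))"
    unfolding isqrt_def by (intro computable_Least) (rule computable_intros | blast)+
qed

lemma computable_left: "computable k f \<Longrightarrow> computable k (\<lambda>xs. left (f xs))"
  unfolding left_def by (intro computable_intros computable_isqrt)

lemma computable_right: "computable k f \<Longrightarrow> computable k (\<lambda>xs. right (f xs))"
  unfolding right_def by (intro computable_intros computable_isqrt computable_left)

section \<open>Decidable equivalence relations from attachments\<close>

text \<open>The orbit of \<open>x\<close> strictly decreases until it meets a fixed point, which
  takes at most \<open>x\<close> steps; further steps change nothing.\<close>

lemma funpow_decreasing_stable:
  fixes f :: "nat \<Rightarrow> nat"
  assumes "\<And>x. f x \<le> x" and "x \<le> n"
  shows "(f ^^ n) x = (f ^^ x) x"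
proof -
  have fix_pt: "f ((f ^^ n) x) = (f ^^ n) x" if "x \<le> n" for n x
    using that
  proof (induction x arbitrary: n rule: less_induct)
    case (less x)
    show ?case
    proof (cases "f x = x")
      case True
      then have "(f ^^ n) x = x" by (induction n) simp_all
      with True show ?thesis by simp
    next
      case False
      then have "f x < x" using assms(1)[of x] by simp
      \<comment> \<open>After one step the start is smaller and the remaining \<open>m\<close> steps
        still suffice for it.\<close>
      with less.prems obtain m where "n = Suc m" "f x \<le> m" by (cases n) auto
      then show ?thesis
        using less.IH[OF \<open>f x < x\<close>, of m] by (simp add: funpow_swap1)
    qed
  qed
  show ?thesis
    using assms(2) by (induction n rule: dec_induct) (simp_all add: fix_pt)
qed

text \<open>
  Every \<open>h (Suc s)\<close> is attached to the class of the smaller number \<open>c s\<close>; all other numbers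
  are roots. The root of \<open>x\<close> is reached from \<open>x\<close> in at most \<open>x\<close> steps.
\<close>

lemma ex_decidable_equivalence:
  fixes h c :: "nat \<Rightarrow> nat"
  assumes E: "equiv UNIV E"
    and h: "computable (Suc 0) (\<lambda>xs. h (hd xs))" and "strict_mono h"
    and c: "computable (Suc 0) (\<lambda>xs. c (hd xs))" and c_le: "\<And>s. c s \<le> s"
    and hE: "\<And>s. (h (Suc s), c s) \<in> E"
    and inf: "\<And>x. infinite {s. c s = x}"
  shows "\<exists>F. decidable F \<and> IC F \<and> F \<subseteq> E \<and> (\<forall>s. (h (Suc s), c s) \<in> F)"
proof -
  have mono: "h m < h n \<longleftrightarrow> m < n" "h m \<le> h n \<longleftrightarrow> m \<le> n" for m n
    using \<open>strict_mono h\<close> by (simp_all add: strict_mono_less strict_mono_less_eq)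
  have h_ge: "s \<le> h s" for s
    using strict_mono_imp_increasing[OF \<open>strict_mono h\<close>] .
  \<comment> \<open>As \<open>h\<close> increases, only this \<open>s\<close> can satisfy
    \<open>h (Suc s) = x\<close>, so one comparison decides whether \<open>x\<close> is
    attached.\<close>
  define stage where "stage x = (LEAST s. x \<le> h (Suc s))" for x
  define f where "f x = (if h (Suc (stage x)) = x then c (stage x) else x)" for x
  define root where "root x = (f ^^ x) x" for x
  \<comment> \<open>Equality of roots is an equivalence relation by its form and decidable because
    \<open>root\<close> is computable.\<close>
  define F where "F = {(x, y). root x = root y}"
  have stage: "stage (h (Suc s)) = s" for s
    unfolding stage_def by (rule Least_equality) (simp_all add: mono)
  have f_h: "f (h (Suc s)) = c s" for s
    by (simp add: f_def stage)
  have f_le: "f x \<le> x" for x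
  proof (cases "h (Suc (stage x)) = x")
    case True
    have "c (stage x) \<le> Suc (stage x)"
      using c_le[of "stage x"] by simp
    also have "\<dots> \<le> x"
      using h_ge[of "Suc (stage x)"] True by simp
    finally show ?thesis
      by (simp add: f_def)
  qed (simp add: f_def)
  have root_f: "root (f x) = root x" for x
  proof -
    \<comment> \<open>\<open>root\<close> takes as many steps as its argument says; by stability
      \<open>f x\<close> may take \<open>x\<close> steps and \<open>x\<close> itself one
      more.\<close>
    have "root (f x) = (f ^^ x) (f x)"
      unfolding root_def by (rule funpow_decreasing_stable[symmetric]) (rule f_le)+
    also have "\<dots> = (f ^^ Suc x) x"
      by (simp add: funpow_swap1)
    also have "\<dots> = root x"
      unfolding root_def by (rule funpow_decreasing_stable) (simp_all add: f_le)
    finally show ?thesis .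
  qed
  have refl_E: "(x, x) \<in> E" for x
    using E by (simp add: equiv_def refl_on_def)
  have f_E: "(x, f x) \<in> E" for x
    using hE[of "stage x"] refl_E[of x] by (auto simp: f_def)
  have pow_E: "(x, (f ^^ n) x) \<in> E" for n x
  proof (induction n)
    case 0
    show ?case by (simp add: refl_E)
  next
    case (Suc n)
    then show ?case
      using f_E[of "(f ^^ n) x"] E unfolding equiv_def by (auto elim: transE)
  qed
  have "F \<subseteq> E"
  proof
    fix z assume "z \<in> F"
    then obtain x y where z: "z = (x, y)" and "root x = root y"
      unfolding F_def by blast
    then have "(x, root x) \<in> E" "(y, root x) \<in> E"
      using pow_E[of x x] pow_E[of y y] by (simp_all add: root_def)
    then show "z \<in> E"
      using E unfolding z equiv_def by (meson symE transE)
  qed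
  moreover have attached: "(h (Suc s), c s) \<in> F" for s
    using root_f[of "h (Suc s)"] by (simp add: F_def f_h)
  moreover have "IC F"
    unfolding IC_def
  proof (intro conjI ballI)
    show "equiv UNIV F"
      by (rule equivI) (auto simp: F_def refl_on_def sym_def trans_def)
    fix C assume "C \<in> UNIV // F"
    then obtain x where C: "C = F `` {x}"
      by (rule quotientE)
    \<comment> \<open>The class of \<open>x\<close> contains all numbers attached to
      \<open>x\<close>; by \<open>inf\<close> and injectivity of \<open>h\<close> they are
      infinitely many.\<close>
    have "(\<lambda>s. h (Suc s)) ` {s. c s = x} \<subseteq> C"
      using attached by (auto simp: C F_def)
    moreover have "inj_on (\<lambda>s. h (Suc s)) {s. c s = x}"
      using strict_mono_eq[OF \<open>strict_mono h\<close>] by (auto simp: inj_on_def)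
    ultimately show "infinite C"
      using inf[of x] by (meson finite_imageD finite_subset)
  qed
  moreover have "decidable F"
  proof -
    have comp_stage: "computable k (\<lambda>xs. stage (g xs))" if "computable k g" for k g
    proof (rule computable_comp1[of stage, OF _ that])
      have "\<exists>s. x \<le> h (Suc s)" for x
        using h_ge[of "Suc x"] by (intro exI[of _ x]) simp
      then show "computable (Suc 0) (\<lambda>xs. stage (hd xs))"
        unfolding stage_def
        by (intro computable_Least) (rule computable_intros computable_comp1[OF h] | blast)+
    qed
    have comp_f: "computable k (\<lambda>xs. f (g xs))" if "computable k g" for k g
      unfolding f_def
      by (rule computable_intros computable_comp1[OF h] computable_comp1[OF c] comp_stage that)+
    have "(f ^^ n) x = rec_nat x (\<lambda>m r. f r) n" for n x
      by (induction n) simp_all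
    then have comp_root: "computable k (\<lambda>xs. root (g xs))" if "computable k g" for k g
      unfolding root_def by simp (rule computable_rec_nat comp_f computable_list_intros that)+
    show ?thesis
      unfolding decidable_iff_computable F_def by simp (rule computable_intros comp_root)+
  qed
  ultimately show ?thesis
    by blast
qed

section \<open>The relations \<open>F\<close> and \<open>G\<close> for a given
  \<open>E\<close>\<close>

theorem proposition4:
  fixes E :: "(nat \<times> nat) set"
  assumes "semi_decidable E" and "IC E"
  shows "\<exists>F G :: (nat \<times> nat) set.
    decidable F \<and> IC F \<and> decidable G \<and> IC G \<and> E = F O G O F \<and> E = (F \<union> G)\<^sup>+"
proof -
  from \<open>semi_decidable E\<close> obtain T where
    T: "computable (Suc (Suc (Suc 0))) (\<lambda>xs. of_bool (T (hd xs) (hd (tl xs)) (hd (tl (tl xs)))))"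
    and T_sound: "\<And>t x y. T t x y \<Longrightarrow> (x, y) \<in> E"
    and T_complete: "\<And>x y. (x, y) \<in> E \<Longrightarrow> \<forall>\<^sub>F t in sequentially. T t x y"
    by (rule semi_decidable_stages) blast
  have equiv_E: "equiv UNIV E" and infinite_class: "\<And>x. infinite (E `` {x})"
    using \<open>IC E\<close> by (auto simp: IC_def quotientI)
  then have refl_E: "(x, x) \<in> E" and sym_E: "(x, y) \<in> E \<Longrightarrow> (y, x) \<in> E"
    and trans_E: "(x, y) \<in> E \<Longrightarrow> (y, z) \<in> E \<Longrightarrow> (x, z) \<in> E" for x y z
    by (auto simp: equiv_def refl_on_def elim: symE transE)
  have comp_T: "computable k (\<lambda>xs. of_bool (T (f1 xs) (f2 xs) (f3 xs)))"
    if "computable k f1" "computable k f2" "computable k f3" for k f1 f2 f3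
    using computable_comp[OF T, of k "\<lambda>xs. [f1 xs, f2 xs, f3 xs]"] that
    by (simp add: computable_list_intros)

  \<comment> \<open>\<open>s\<close> is both the bound of a test and, through \<open>left s\<close>,
    the code of the pair tested. As \<open>left\<close> takes each value at arbitrarily large
    arguments, each pair is tested under arbitrarily large bounds.\<close>
  define fst_at where "fst_at s = left (left s)" for s
  define snd_at where "snd_at s = right (left s)" for s
  \<comment> \<open>A failed test yields the pair (0, 0), which lies in \<open>E\<close> by
    reflexivity and has components at most \<open>s\<close>.\<close>
  define a where "a s = (if T s (fst_at s) (snd_at s) then fst_at s else 0)" for s
  define b where "b s = (if T s (fst_at s) (snd_at s) then snd_at s else 0)" for s
  have ab_E: "(a s, b s) \<in> E" for s
    by (simp add: a_def b_def T_sound refl_E)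
  have a_le: "a s \<le> s" and b_le: "b s \<le> s" for s
    using left_le[of s] left_le[of "left s"] right_le[of "left s"]
    by (simp_all add: a_def b_def fst_at_def snd_at_def)
  have ab_infinite: "infinite {s. a s = x \<and> b s = y}" if xy: "(x, y) \<in> E" for x y
    unfolding infinite_nat_iff_unbounded_le
  proof
    fix m
    obtain N where N: "\<And>t. N \<le> t \<Longrightarrow> T t x y"
      using T_complete[OF xy] unfolding eventually_sequentially by blast
    obtain n where n: "left n = x" "right n = y"
      using ex_left_right by blast
    obtain s where "max m N \<le> s" "left s = n"
      using ex_left_ge by blast
    then show "\<exists>s\<ge>m. s \<in> {s. a s = x \<and> b s = y}"
      using N n by (intro exI[of _ s]) (simp add: a_def b_def fst_at_def snd_at_def)
  qed
  have comp_a: "computable k (\<lambda>xs. a (f xs))" and comp_b: "computable k (\<lambda>xs. b (f xs))"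
    if "computable k f" for k f
    unfolding a_def b_def fst_at_def snd_at_def
    by (intro computable_if computable_const computable_left computable_right comp_T that)+

  \<comment> \<open>\<open>n\<close> codes the candidate \<open>left n\<close> and bounds the test
    that it is equivalent to \<open>a s\<close>; \<open>r\<close> is the previous value of
    \<open>h\<close>, which must be exceeded.\<close>
  define found where "found s r n \<longleftrightarrow> r < left n \<and> T n (left n) (a s)" for s r n
  define step where "step s r = left (LEAST n. found s r n)" for s r
  define h where "h = rec_nat 0 step"
  have ex_found: "\<exists>n. found s r n" for s r
  proof -
    \<comment> \<open>An infinite class has a member above \<open>r\<close>. It is confirmed under
      all large bounds, and some of these code it.\<close>
    obtain x where "r < x" and x: "(a s, x) \<in> E"
      using infinite_class[of "a s"] unfolding infinite_nat_iff_unbounded by blast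
    obtain N where N: "\<And>t. N \<le> t \<Longrightarrow> T t x (a s)"
      using T_complete[OF sym_E[OF x]] unfolding eventually_sequentially by blast
    obtain n where "N \<le> n" "left n = x"
      using ex_left_ge by blast
    then show ?thesis
      using N \<open>r < x\<close> unfolding found_def by blast
  qed
  have "found s r (LEAST n. found s r n)" for s r
    using ex_found by (rule LeastI_ex)
  then have step_gt: "r < step s r" and step_E: "(step s r, a s) \<in> E" for s r
    unfolding step_def found_def by (blast dest: T_sound)+
  have h_mono: "strict_mono h"
    by (simp add: strict_mono_Suc_iff h_def step_gt)
  have h_a: "(h (Suc s), a s) \<in> E" for s
    by (simp add: h_def step_E)
  have h_b: "(h (Suc s), b s) \<in> E" for s
    using trans_E[OF h_a ab_E] .
  have comp_h: "computable (Suc 0) (\<lambda>xs. h (hd xs))"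
  proof -
    have "computable (Suc (Suc 0)) (\<lambda>xs. step (hd xs) (hd (tl xs)))"
      unfolding step_def found_def
      by (intro computable_left computable_Least)
        (rule computable_intros computable_left comp_T comp_a
          | rule ex_found[unfolded found_def])+
    note comp_step = computable_comp2[of step, OF this]
    show ?thesis
      unfolding h_def
      by (rule computable_rec_nat comp_step computable_const computable_list_intros)+
  qed

  \<comment> \<open>The pair \<open>(x, x)\<close> lies in \<open>E\<close> and is enumerated
    infinitely often, which serves both components.\<close>
  have "infinite {s. a s = x}" "infinite {s. b s = x}" for x
    using ab_infinite[OF refl_E, of x] by (auto elim!: contrapos_nn intro: finite_subset[rotated])
  note inf = this
  \<comment> \<open>The same \<open>h\<close> is attached once along \<open>b\<close> and once along
    \<open>a\<close>, so that its values link the two relations.\<close>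
  obtain F where F: "decidable F" "IC F" "F \<subseteq> E" and F_b: "\<And>s. (h (Suc s), b s) \<in> F"
    using ex_decidable_equivalence[OF equiv_E comp_h h_mono comp_b b_le h_b inf(2)]
      computable_hd[OF computable_list_id] by blast
  obtain G where G: "decidable G" "IC G" "G \<subseteq> E" and G_a: "\<And>s. (h (Suc s), a s) \<in> G"
    using ex_decidable_equivalence[OF equiv_E comp_h h_mono comp_a a_le h_a inf(1)]
      computable_hd[OF computable_list_id] by blast
  have refl_F: "(x, x) \<in> F" and sym_G: "(x, y) \<in> G \<Longrightarrow> (y, x) \<in> G" for x y
    using F(2) G(2) by (auto simp: IC_def equiv_def refl_on_def elim: symE)
  have E_GF: "(x, y) \<in> G O F" if xy: "(x, y) \<in> E" for x y
  proof -
    obtain s where "a s = x" "b s = y"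
      using infinite_imp_nonempty[OF ab_infinite[OF xy]] by blast
    then show ?thesis
      using F_b[of s] sym_G[OF G_a[of s]] by blast
  qed
  have "E = F O G O F"
  proof
    show "E \<subseteq> F O G O F"
      \<comment> \<open>The first factor \<open>F\<close> is filled by reflexivity.\<close>
      by (rule subrelI) (rule relcompI[OF refl_F E_GF])
    show "F O G O F \<subseteq> E"
      using F(3) G(3) trans_E by blast
  qed
  moreover have "E = (F \<union> G)\<^sup>+"
  proof
    show "E \<subseteq> (F \<union> G)\<^sup>+"
    proof (rule subrelI)
      fix x z assume "(x, z) \<in> E"
      then obtain y where "(x, y) \<in> G" "(y, z) \<in> F"
        using E_GF by blast
      then show "(x, z) \<in> (F \<union> G)\<^sup>+"
        by (blast intro: trancl_into_trancl)
    qed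
    have "(F \<union> G)\<^sup>+ \<subseteq> E\<^sup>+"
      using F(3) G(3) by (intro trancl_mono_subset) blast
    also have "E\<^sup>+ = E"
      using equiv_E by (intro trancl_id) (simp add: equiv_def)
    finally show "(F \<union> G)\<^sup>+ \<subseteq> E" .
  qed
  ultimately show ?thesis
    using F G by blast
qed

end
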